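(* Let $\beta,\beta'$ be two observers in Minkowski spacetime, let $U$ be the 4-velocity of $\beta$, let $S_{\mathrm{obs}}$ be the relative position of $\beta'$ observed by $\beta$, and let $V_{\mathrm{ast}}$ and $V_{\mathrm{spec}}$ be the astrometric relative velocity and the spectroscopic relative velocity of $\beta'$ observed by $\beta$. Then, along $\beta$, $$V_{\mathrm{ast}}=\|S_{\mathrm{obs}}\|\,\nabla_U U+\frac{1}{1+g\left(V_{\mathrm{spec}},\frac{S_{\mathrm{obs}}}{\|S_{\mathrm{obs}}\|}\right)}\,V_{\mathrm{spec}}.$$
   Context: Minkowski spacetime is the 4-dimensional affine space with flat metric $g$ of signature $(-,+,+,+)$, $c=1$, with a fixed time orientation; $\nabla$ is the Levi-Civita connection (so, for a vector field $X$ along $\beta$ with $\beta$ parameterized by proper time $\tau$, $\nabla_U X=\frac{dX}{d\tau}$). For events $p,q$, $q-p$ denotes the vector joining $p$ to $q$. For a spacelike vector $x$, $\|x\|=\sqrt{g(x,x)}$. An observer is a (smooth) future-directed timelike curve $\beta:I\to\mathcal M$, with $I\subset\mathbb R$ an interval, parameterized by proper time and identified with its image; its 4-velocity $U$ is its tangent field, which satisfies $g(U,U)=-1$. $U'$ denotes the 4-velocity of $\beta'$. For an event $p$, $E_p^-$ is the set of events $q\neq p$ such that $q-p$ is a past-pointing lightlike vector. Observed relative position: it is assumed that for every $p\in\beta$ there is a unique event $q$ of $\beta'\cap E_p^-$. The relative position of $\beta'$ observed by $\beta$ is the vector field $S_{\mathrm{obs}}$ along $\beta$ given by $S_{\mathrm{obs}\,p}=(q-p)+g(q-p,U_p)\,U_p$.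 Astrometric relative velocity of $\beta'$ observed by $\beta$: $V_{\mathrm{ast}}:=\nabla_U S_{\mathrm{obs}}+g(\nabla_U S_{\mathrm{obs}},U)\,U$, a vector field along $\beta$. Spectroscopic relative velocity of $\beta'$ observed by $\beta$: the vector field along $\beta$ given at $p\in\beta$ by $$V_{\mathrm{spec}\,p}:=\frac{1}{-g(\tau_{qp}U'_q,U_p)}\,\tau_{qp}U'_q-U_p,$$ where $q$ is the unique event of $\beta'\cap E_p^-$ and $\tau_{qp}$ is parallel transport from $q$ to $p$ along the geodesic joining them (in Minkowski spacetime, the identification of vectors at $q$ and at $p$ by the affine structure). *)

theory Defs
  imports "HOL-Analysis.Analysis"
begin

text \<open>
  Minkowski spacetime in inertial coordinates (with c = 1): a pair consists of the time
  coordinate and the space coordinates. Events and vectors share this type; the vector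
  joining p to q is q - p, and vectors at different events are identified by the affine structure.
\<close>
type_synonym minkowski = "real \<times> (real ^ 3)"

definition mink :: "minkowski \<Rightarrow> minkowski \<Rightarrow> real" where
  "mink x y = - (fst x * fst y) + snd x \<bullet> snd y"

definition mnorm :: "minkowski \<Rightarrow> real" where
  "mnorm x = sqrt (mink x x)"

definition timelike :: "minkowski \<Rightarrow> bool" where
  "timelike x \<longleftrightarrow> mink x x < 0"

definition lightlike :: "minkowski \<Rightarrow> bool" where
  "lightlike x \<longleftrightarrow> x \<noteq> 0 \<and> mink x x = 0"

text \<open>The time orientation; the next two notions are meant for timelike and lightlike vectors only.\<close>
definition future_pointing :: "minkowski \<Rightarrow> bool" where
  "future_pointing x \<longleftrightarrow> 0 < fst x"

definition past_pointing :: "minkowski \<Rightarrow> bool" where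
  "past_pointing x \<longleftrightarrow> fst x < 0"

definition past_lightcone :: "minkowski \<Rightarrow> minkowski set" where
  "past_lightcone p = {q. q \<noteq> p \<and> lightlike (q - p) \<and> past_pointing (q - p)}"

text \<open>
  Infinite differentiability on a nondegenerate interval, one-sided at endpoints that belong
  to the interval: D n is the n-th derivative.
\<close>
definition smooth_curve_on :: "real set \<Rightarrow> (real \<Rightarrow> minkowski) \<Rightarrow> bool" where
  "smooth_curve_on I \<beta> \<longleftrightarrow>
     (\<exists>D :: nat \<Rightarrow> real \<Rightarrow> minkowski.
        (\<forall>t\<in>I. D 0 t = \<beta> t) \<and>
        (\<forall>n. \<forall>t\<in>I. (D n has_vector_derivative D (Suc n) t) (at t within I)))"

text \<open>
  A vector field along a curve parameterized on I is a function of the parameter, of which only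
  the values on I matter. In inertial coordinates its covariant derivative along
  the curve, with respect to the Levi-Civita connection, is the ordinary derivative.
\<close>
definition nabla_along :: "real set \<Rightarrow> (real \<Rightarrow> minkowski) \<Rightarrow> real \<Rightarrow> minkowski" where
  "nabla_along I X t = vector_derivative X (at t within I)"

definition four_velocity :: "real set \<Rightarrow> (real \<Rightarrow> minkowski) \<Rightarrow> real \<Rightarrow> minkowski" where
  "four_velocity I \<beta> t = vector_derivative \<beta> (at t within I)"

definition observer :: "real set \<Rightarrow> (real \<Rightarrow> minkowski) \<Rightarrow> bool" where
  "observer I \<beta> \<longleftrightarrow>
     is_interval I \<and> interior I \<noteq> {} \<and> smooth_curve_on I \<beta> \<and>
     (\<forall>t\<in>I. timelike (four_velocity I \<beta> t) \<and> future_pointing (four_velocity I \<beta> t) \<and>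
             mink (four_velocity I \<beta> t) (four_velocity I \<beta> t) = - 1)"

text \<open>
  An observer is injective, its time coordinate being strictly increasing, so for an event q on it
  the parameter chosen by inv_into is the unique proper time at which the observer is at q.
\<close>
definition four_velocity_at :: "real set \<Rightarrow> (real \<Rightarrow> minkowski) \<Rightarrow> minkowski \<Rightarrow> minkowski" where
  "four_velocity_at I \<beta> q = four_velocity I \<beta> (inv_into I \<beta> q)"

definition observed_event :: "real set \<Rightarrow> (real \<Rightarrow> minkowski) \<Rightarrow> minkowski \<Rightarrow> minkowski" where
  "observed_event I' \<beta>' p = (THE q. q \<in> \<beta>' ` I' \<inter> past_lightcone p)"

text \<open>In the next three definitions (I, \<open>\<beta>\<close>) observes (I', \<open>\<beta>'\<close>), and t is the proper time of \<open>\<beta>\<close>.\<close>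
definition S_obs ::
  "real set \<Rightarrow> (real \<Rightarrow> minkowski) \<Rightarrow> real set \<Rightarrow> (real \<Rightarrow> minkowski) \<Rightarrow> real \<Rightarrow> minkowski" where
  "S_obs I \<beta> I' \<beta>' t =
     (let p = \<beta> t; q = observed_event I' \<beta>' p; U = four_velocity I \<beta> t
      in (q - p) + mink (q - p) U *\<^sub>R U)"

definition V_ast ::
  "real set \<Rightarrow> (real \<Rightarrow> minkowski) \<Rightarrow> real set \<Rightarrow> (real \<Rightarrow> minkowski) \<Rightarrow> real \<Rightarrow> minkowski" where
  "V_ast I \<beta> I' \<beta>' t =
     (let W = nabla_along I (S_obs I \<beta> I' \<beta>') t; U = four_velocity I \<beta> t
      in W + mink W U *\<^sub>R U)"

text \<open>Parallel transport from q to p is the identity on components in inertial coordinates.\<close>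
definition V_spec ::
  "real set \<Rightarrow> (real \<Rightarrow> minkowski) \<Rightarrow> real set \<Rightarrow> (real \<Rightarrow> minkowski) \<Rightarrow> real \<Rightarrow> minkowski" where
  "V_spec I \<beta> I' \<beta>' t =
     (let p = \<beta> t; q = observed_event I' \<beta>' p; U = four_velocity I \<beta> t;
          U' = four_velocity_at I' \<beta>' q
      in (1 / (- mink U' U)) *\<^sub>R U' - U)"

end

theory Submission
  imports Defs
begin

text \<open>
  Let \<open>s t\<close> be the proper time at which \<open>\<beta>'\<close> emits the light received by \<open>\<beta>\<close> at \<open>t\<close>, and
  put \<open>L = \<beta>' (s t) - \<beta> t\<close>. Since \<open>L\<close> is null and past-pointing, \<open>r = g(L, U)\<close> is positive and equals
  the norm of \<open>S = L + r U\<close>. Once \<open>s\<close> is known to be differentiable, \<open>g(L, L) = 0\<close> gives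
  \<open>s' = g(L, U) / g(L, U')\<close>, and projecting the derivative of \<open>S\<close> orthogonally to \<open>U\<close> gives
  \<open>V_ast = r \<nabla>\<^sub>U U + s' (U' + g(U', U) U)\<close>, where \<open>U' + g(U', U) U = - g(U', U) V_spec\<close>. Finally
  \<open>1 + g(V_spec, S / r) = 1 / (- g(U', U) s')\<close>.

  Continuity of \<open>s\<close> uses no implicit function theorem (which would not cover endpoints of the
  intervals): \<open>\<sigma> = s t\<close> is the zero of \<open>height (\<beta> t - \<beta>' \<sigma>)\<close>, where \<open>height x = fst x - norm (snd x)\<close>; this
  function is strictly decreasing in \<open>\<sigma>\<close> and continuous in \<open>t\<close>.
\<close>

section \<open>Causal vectors\<close>

lemma mink_commute: "mink x y = mink y x"
  by (simp add: mink_def inner_commute mult.commute)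

text \<open>This supplies limits and product rules for the indefinite form. The constant 2 counts
  its time term and its space term.\<close>

lemma bounded_bilinear_mink: "bounded_bilinear mink"
proof -
  have "\<bar>mink a b\<bar> \<le> norm a * norm b * 2" for a b :: minkowski
  proof -
    have "norm (fst c) \<le> norm c" "norm (snd c) \<le> norm c" for c :: minkowski
      using norm_fst_le[of "fst c" "snd c"] norm_snd_le[of "snd c" "fst c"] by simp_all
    then have "norm (fst a) * norm (fst b) \<le> norm a * norm b"
      "norm (snd a) * norm (snd b) \<le> norm a * norm b"
      by (simp_all add: mult_mono)
    then show ?thesis
      using Cauchy_Schwarz_ineq2[of "snd a" "snd b"] by (simp add: mink_def abs_mult[symmetric])
  qed
  then show ?thesis
    by unfold_locales
      (auto simp: mink_def algebra_simps inner_add_left inner_add_right intro!: exI[of _ 2])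
qed

interpretation mink: bounded_bilinear mink
  by (rule bounded_bilinear_mink)

text \<open>Positive exactly on future-pointing timelike vectors, zero exactly on future-pointing
  null vectors and 0. Unlike the quadratic form, it distinguishes future from past and is
  superadditive.\<close>

definition height :: "minkowski \<Rightarrow> real" where
  "height x = fst x - norm (snd x)"

lemma height_add: "height x + height y \<le> height (x + y)"
  unfolding height_def using norm_triangle_ineq[of "snd x" "snd y"] by simp

text \<open>Spatial Cauchy-Schwarz. Only \<open>y\<close> has to be timelike, so \<open>x\<close>
  may be the reversed light ray.\<close>

lemma mink_neg:
  assumes "0 \<le> height x" "0 < fst x" "0 < height y"
  shows "mink x y < 0"
proof -
  have "snd x \<bullet> snd y \<le> norm (snd x) * norm (snd y)"
    by (rule norm_cauchy_schwarz)
  also have "\<dots> \<le> fst x * norm (snd y)"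
    using assms by (intro mult_right_mono) (auto simp: height_def)
  also have "\<dots> < fst x * fst y"
    using assms by (intro mult_strict_left_mono) (auto simp: height_def)
  finally show ?thesis by (simp add: mink_def)
qed

text \<open>A difference of squares; when \<open>0 < fst x\<close> the last factor is positive and
  \<open>height\<close> decides the sign.\<close>

lemma mink_self_eq: "mink x x = - (height x * (fst x + norm (snd x)))"
  by (simp add: mink_def height_def dot_square_norm power2_eq_square algebra_simps)

lemma height_pos_iff:
  assumes "0 < fst x"
  shows "0 < height x \<longleftrightarrow> mink x x < 0"
proof -
  have "0 < fst x + norm (snd x)" using assms by (simp add: add_pos_nonneg)
  then show ?thesis by (auto simp: mink_self_eq zero_less_mult_iff)
qed

lemma height_zero_iff:
  assumes "0 < fst x"
  shows "height x = 0 \<longleftrightarrow> mink x x = 0"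
proof -
  have "0 < fst x + norm (snd x)" using assms by (simp add: add_pos_nonneg)
  then show ?thesis by (auto simp: mink_self_eq)
qed

lemma past_lightcone_iff:
  "q \<in> past_lightcone p \<longleftrightarrow> 0 < fst (p - q) \<and> height (p - q) = 0"
proof -
  have "mink (q - p) (q - p) = mink (p - q) (p - q)"
    by (metis minus_diff_eq mink.minus_left mink.minus_right minus_minus)
  then show ?thesis
    using height_zero_iff[of "p - q"]
    by (auto simp: past_lightcone_def lightlike_def past_pointing_def)
qed

section \<open>Observers\<close>

text \<open>A connected set with nonempty interior is not a singleton, so each of its points,
  endpoints included, is a limit point. Derivatives within \<open>I\<close> are therefore
  unique.\<close>

lemma observer_not_bot:
  assumes "observer I \<beta>" "t \<in> I"
  shows "at t within I \<noteq> bot"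
proof -
  have "connected I" "interior I \<noteq> {}"
    using assms by (auto simp: observer_def is_interval_connected)
  moreover have "\<nexists>x. I = {x}"
    using \<open>interior I \<noteq> {}\<close> by auto
  ultimately show ?thesis
    using assms(2) connected_imp_perfect[of I t] by (auto simp: trivial_limit_within)
qed

lemma observer_vector_derivative:
  assumes "observer I \<beta>" "t \<in> I" "(f has_vector_derivative d) (at t within I)"
  shows "vector_derivative f (at t within I) = d"
  using observer_not_bot[OF assms(1,2)] assms(3) by (rule vector_derivative_within)

lemma observer_has_four_velocity:
  assumes "observer I \<beta>" "t \<in> I"
  shows "(\<beta> has_vector_derivative four_velocity I \<beta> t) (at t within I)"
proof -
  obtain D where D: "\<forall>t\<in>I. D 0 t = \<beta> t"
    "\<forall>n. \<forall>t\<in>I. (D n has_vector_derivative D (Suc n) t) (at t within I)"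
    using assms unfolding observer_def smooth_curve_on_def by auto
  have "(\<beta> has_vector_derivative D (Suc 0) t) (at t within I)"
    using D assms(2) by (auto intro: has_vector_derivative_transform[where f = "D 0"])
  then show ?thesis
    unfolding four_velocity_def by (simp only: observer_vector_derivative[OF assms])
qed

lemma observer_has_acceleration:
  assumes "observer I \<beta>" "t \<in> I"
  shows "(four_velocity I \<beta> has_vector_derivative nabla_along I (four_velocity I \<beta>) t)
    (at t within I)"
proof -
  obtain D where D: "\<forall>t\<in>I. D 0 t = \<beta> t"
    "\<forall>n. \<forall>t\<in>I. (D n has_vector_derivative D (Suc n) t) (at t within I)"
    using assms unfolding observer_def smooth_curve_on_def by auto
  have "four_velocity I \<beta> x = D (Suc 0) x" if "x \<in> I" for x
  proof -
    have "(\<beta> has_vector_derivative D (Suc 0) x) (at x within I)"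
      using D that by (auto intro: has_vector_derivative_transform[where f = "D 0"])
    then show ?thesis
      using observer_vector_derivative[OF assms(1) that] by (simp add: four_velocity_def)
  qed
  then have "(four_velocity I \<beta> has_vector_derivative D (Suc (Suc 0)) t) (at t within I)"
    using D assms(2) by (auto intro: has_vector_derivative_transform[where f = "D (Suc 0)"])
  then show ?thesis
    unfolding nabla_along_def by (simp only: observer_vector_derivative[OF assms])
qed

lemma four_velocity_future:
  assumes "observer I \<beta>" "t \<in> I"
  shows "0 < height (four_velocity I \<beta> t)" "0 < fst (four_velocity I \<beta> t)"
    "mink (four_velocity I \<beta> t) (four_velocity I \<beta> t) = - 1"
  using assms by (auto simp: observer_def timelike_def future_pointing_def height_pos_iff)

text \<open>Differentiate the constant \<open>mink U U = - 1\<close>.\<close>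

lemma acceleration_orthogonal:
  assumes "observer I \<beta>" "t \<in> I"
  shows "mink (nabla_along I (four_velocity I \<beta>) t) (four_velocity I \<beta> t) = 0"
proof -
  let ?U = "four_velocity I \<beta>" and ?a = "nabla_along I (four_velocity I \<beta>) t"
  have "((\<lambda>x. mink (?U x) (?U x)) has_vector_derivative mink (?U t) ?a + mink ?a (?U t))
      (at t within I)"
    by (intro mink.has_vector_derivative observer_has_acceleration assms)
  moreover have "((\<lambda>x. mink (?U x) (?U x)) has_vector_derivative 0) (at t within I)"
    using assms
    by (auto intro: has_vector_derivative_transform[where f = "\<lambda>_. - 1"]
        simp: four_velocity_future)
  ultimately have "mink (?U t) ?a + mink ?a (?U t) = 0"
    using observer_vector_derivative[OF assms] by metis
  then show ?thesis by (simp add: mink_commute)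
qed

text \<open>\<open>height\<close> need not be differentiable where the spatial part vanishes, so it
  is replaced by a linear functional that dominates it and agrees with it on the chord; this
  functional increases along the curve.\<close>

lemma observer_chord:
  assumes obs: "observer I \<beta>" and ab: "a \<in> I" "b \<in> I" "a < b"
  shows "0 < height (\<beta> b - \<beta> a)"
proof -
  \<comment> \<open>The unit spatial direction of the chord, or 0 if the chord has no spatial
    part.\<close>
  define n where "n = sgn (snd (\<beta> b - \<beta> a))"
  define f where "f = (\<lambda>x :: minkowski. fst x - n \<bullet> snd x)"
  have f_lin: "bounded_linear f"
    unfolding f_def
    by (intro bounded_linear_sub bounded_linear_fst bounded_linear_inner_right_comp
        bounded_linear_snd)
  have f_ge: "height x \<le> f x" for x
  proof -
    have "n \<bullet> snd x \<le> norm n * norm (snd x)" by (rule norm_cauchy_schwarz)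
    also have "\<dots> \<le> 1 * norm (snd x)"
      by (intro mult_right_mono) (auto simp: n_def norm_sgn)
    finally show ?thesis by (simp add: f_def height_def)
  qed
  have sub: "{a..b} \<subseteq> I"
    using obs ab by (auto simp: observer_def intro: mem_is_interval_1_I)
  have der: "((\<lambda>x. f (\<beta> x)) has_vector_derivative f (four_velocity I \<beta> x)) (at x within {a..b})"
    if "x \<in> {a..b}" for x
    using bounded_linear.has_vector_derivative[OF f_lin observer_has_four_velocity[OF obs]] that sub
    by (blast intro: has_vector_derivative_within_subset)
  have "f (\<beta> a) < f (\<beta> b)"
  \<comment> \<open>Two-sided derivatives are available only inside the interval, since
    \<open>a\<close> and \<open>b\<close> may be endpoints of \<open>I\<close>; there continuity
    suffices.\<close>
  proof (rule DERIV_pos_imp_increasing_open[OF ab(3)])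
    fix x assume x: "a < x" "x < b"
    have "at x within {a..b} = at x"
      using x by (intro at_within_interior) auto
    then have "((\<lambda>x. f (\<beta> x)) has_real_derivative f (four_velocity I \<beta> x)) (at x)"
      using der[of x] x by (simp add: has_real_derivative_iff_has_vector_derivative)
    moreover have "x \<in> I" using x sub by auto
    then have "0 < f (four_velocity I \<beta> x)"
      using four_velocity_future(1)[OF obs] f_ge less_le_trans by blast
    ultimately show "\<exists>y. ((\<lambda>x. f (\<beta> x)) has_real_derivative y) (at x) \<and> 0 < y" by blast
  next
    show "continuous_on {a..b} (\<lambda>x. f (\<beta> x))"
      using der by (meson continuous_on_eq_continuous_within has_vector_derivative_continuous)
  qed
  moreover have "f (\<beta> b - \<beta> a) = height (\<beta> b - \<beta> a)"
    unfolding f_def n_def height_def sgn_div_norm inner_scaleR_left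
    by (cases "snd (\<beta> b - \<beta> a) = 0") (simp_all add: dot_square_norm power2_eq_square del: snd_diff)
  ultimately show ?thesis
    using bounded_linear.linear[OF f_lin] by (simp add: linear_diff)
qed

section \<open>Derivatives within a set as limits of difference quotients\<close>

lemma has_vector_derivative_iff_slope:
  "(f has_vector_derivative d) (at t within I) \<longleftrightarrow>
    ((\<lambda>x. (f x - f t) /\<^sub>R (x - t)) \<longlongrightarrow> d) (at t within I)"
proof -
  have eq: "norm ((1 / norm (x - t)) *\<^sub>R (f x - (f t + (x - t) *\<^sub>R d))) =
      norm ((f x - f t) /\<^sub>R (x - t) - d)" if "x \<noteq> t" for x
  proof -
    have "(f x - f t) /\<^sub>R (x - t) - d = (1 / (x - t)) *\<^sub>R (f x - (f t + (x - t) *\<^sub>R d))"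
      using that by (simp add: scaleR_diff_right scaleR_add_right divide_inverse)
    then show ?thesis by simp
  qed
  have "(f has_vector_derivative d) (at t within I) \<longleftrightarrow>
      ((\<lambda>x. norm ((1 / norm (x - t)) *\<^sub>R (f x - (f t + (x - t) *\<^sub>R d)))) \<longlongrightarrow> 0) (at t within I)"
    by (simp only: has_vector_derivative_def has_derivative_within bounded_linear_scaleR_left
        tendsto_norm_zero_iff simp_thms)
  also have "\<dots> \<longleftrightarrow> ((\<lambda>x. norm ((f x - f t) /\<^sub>R (x - t) - d)) \<longlongrightarrow> 0) (at t within I)"
    by (intro filterlim_cong refl, unfold eventually_at_filter)
      (intro always_eventually allI impI, erule eq)
  finally show ?thesis
    by (simp only: tendsto_norm_zero_iff Lim_null[symmetric])
qed

text \<open>Filling in \<open>d\<close> at \<open>t\<close> makes the quotient continuous there, so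
  it can be composed with a function that may take the value \<open>t\<close> at nearby
  points.\<close>

lemma has_vector_derivative_slope:
  assumes "(f has_vector_derivative d) (at t within I)"
  shows "((\<lambda>x. if x = t then d else (f x - f t) /\<^sub>R (x - t)) \<longlongrightarrow> d) (at t within I)"
  using assms unfolding has_vector_derivative_iff_slope
  by (rule Lim_transform_eventually) (auto simp: eventually_at_filter)

section \<open>The emission time\<close>

text \<open>The same choice of parameter as in \<open>four_velocity_at\<close>, so the 4-velocity at
  the observed event unfolds to \<open>U' (s t)\<close>.\<close>

definition emission_time ::
  "real set \<Rightarrow> (real \<Rightarrow> minkowski) \<Rightarrow> (real \<Rightarrow> minkowski) \<Rightarrow> real \<Rightarrow> real" where
  "emission_time I' \<beta>' \<beta> t = inv_into I' \<beta>' (observed_event I' \<beta>' (\<beta> t))"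

locale light_observation =
  fixes I I' :: "real set" and \<beta> \<beta>' :: "real \<Rightarrow> minkowski"
  assumes obs: "observer I \<beta>" and obs': "observer I' \<beta>'"
    and unique: "\<forall>p \<in> \<beta> ` I. \<exists>!q. q \<in> \<beta>' ` I' \<inter> past_lightcone p"
begin

abbreviation s :: "real \<Rightarrow> real" where
  "s \<equiv> emission_time I' \<beta>' \<beta>"

abbreviation L :: "real \<Rightarrow> minkowski" where
  "L t \<equiv> \<beta>' (s t) - \<beta> t"

abbreviation U :: "real \<Rightarrow> minkowski" where
  "U \<equiv> four_velocity I \<beta>"

abbreviation U' :: "real \<Rightarrow> minkowski" where
  "U' \<equiv> four_velocity I' \<beta>'"

lemma emission:
  assumes "t \<in> I"
  shows "s t \<in> I'" "\<beta>' (s t) = observed_event I' \<beta>' (\<beta> t)"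
    "0 < fst (- L t)" "height (- L t) = 0" "mink (L t) (L t) = 0"
proof -
  have "observed_event I' \<beta>' (\<beta> t) \<in> \<beta>' ` I' \<inter> past_lightcone (\<beta> t)"
    unfolding observed_event_def using bspec[OF unique imageI[OF assms]] by (rule theI')
  then show 1: "s t \<in> I'" "\<beta>' (s t) = observed_event I' \<beta>' (\<beta> t)"
    and 2: "0 < fst (- L t)" "height (- L t) = 0"
    by (auto simp: emission_time_def inv_into_into f_inv_into_f past_lightcone_iff)
  show "mink (L t) (L t) = 0"
    using height_zero_iff[OF 2(1)] 2(2) unfolding mink.minus_left mink.minus_right minus_minus by blast
qed

text \<open>\<open>- L t\<close> is future-pointing and null, so \<open>mink_neg\<close> applies
  with the sign reversed. This gives \<open>r > 0\<close> and a positive denominator in the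
  derivative of \<open>s\<close>.\<close>

lemma mink_L_pos:
  assumes "t \<in> I" "0 < height x"
  shows "0 < mink (L t) x"
  using mink_neg[of "- L t" x] emission[OF assms(1)] assms(2) by (simp only: mink.minus_left) simp

text \<open>Superadditivity of \<open>height\<close>, with the chord from \<open>\<beta>' a\<close>
  to \<open>\<beta>' b\<close> as one summand.\<close>

lemma height_emission_antimono:
  assumes "a \<in> I'" "b \<in> I'" "a < b"
  shows "height (p - \<beta>' b) < height (p - \<beta>' a)"
  using observer_chord[OF obs' assms] height_add[of "p - \<beta>' b" "\<beta>' b - \<beta>' a"] by simp

lemma s_tendsto:
  assumes t: "t \<in> I"
  shows "(s \<longlongrightarrow> s t) (at t within I)"
proof -
  have int: "is_interval I'" using obs' by (simp add: observer_def)
  have \<beta>_tendsto: "(\<beta> \<longlongrightarrow> \<beta> t) (at t within I)"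
    using has_vector_derivative_continuous[OF observer_has_four_velocity[OF obs t]]
    by (simp add: continuous_within)
  have lim: "((\<lambda>x. height (\<beta> x - \<beta>' \<sigma>)) \<longlongrightarrow> height (\<beta> t - \<beta>' \<sigma>)) (at t within I)" for \<sigma>
    unfolding height_def by (intro tendsto_intros \<beta>_tendsto)
  have in_I: "\<forall>\<^sub>F x in at t within I. x \<in> I"
    by (auto simp: eventually_at_filter)
  have zero: "height (\<beta> x - \<beta>' (s x)) = 0" if "x \<in> I" for x
    using emission(4)[OF that] by simp
  show ?thesis
  proof (rule order_tendstoI)
    fix \<sigma> assume \<sigma>: "\<sigma> < s t"
    show "\<forall>\<^sub>F x in at t within I. \<sigma> < s x"
    proof (cases "\<sigma> \<in> I'")
      case True
      \<comment> \<open>This sign persists for \<open>x\<close> near \<open>t\<close>, whereas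
        \<open>s x \<le> \<sigma>\<close> would make the height at \<open>\<sigma>\<close>
        nonpositive.\<close>
      have "0 < height (\<beta> t - \<beta>' \<sigma>)"
        using height_emission_antimono[OF True emission(1)[OF t] \<sigma>, of "\<beta> t"] zero[OF t] by simp
      from order_tendstoD(1)[OF lim this] in_I show ?thesis
      proof eventually_elim
        case (elim x)
        show ?case
        proof (rule ccontr)
          assume "\<not> \<sigma> < s x"
          then show False
            using height_emission_antimono[OF emission(1)[OF elim(2)] True, of "\<beta> x"]
              zero[OF elim(2)] elim(1)
            by (cases "s x = \<sigma>") auto
        qed
      qed
    next
      case False
      \<comment> \<open>If \<open>s x \<le> \<sigma> < s t\<close>, the interval \<open>I'\<close>
        would contain \<open>\<sigma>\<close>.\<close>
      from in_I show ?thesis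
      proof eventually_elim
        case (elim x)
        show ?case
          using mem_is_interval_1_I[OF int emission(1)[OF elim] emission(1)[OF t], of \<sigma>] \<sigma> False
          by force
      qed
    qed
  next
    fix \<sigma> assume \<sigma>: "s t < \<sigma>"
    show "\<forall>\<^sub>F x in at t within I. s x < \<sigma>"
    proof (cases "\<sigma> \<in> I'")
      case True
      have "height (\<beta> t - \<beta>' \<sigma>) < 0"
        using height_emission_antimono[OF emission(1)[OF t] True \<sigma>, of "\<beta> t"] zero[OF t] by simp
      from order_tendstoD(2)[OF lim this] in_I show ?thesis
      proof eventually_elim
        case (elim x)
        show ?case
        proof (rule ccontr)
          assume "\<not> s x < \<sigma>"
          then show False
            using height_emission_antimono[OF True emission(1)[OF elim(2)], of "\<beta> x"]
              zero[OF elim(2)] elim(1)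
            by (cases "s x = \<sigma>") auto
        qed
      qed
    next
      case False
      from in_I show ?thesis
      proof eventually_elim
        case (elim x)
        show ?case
          using mem_is_interval_1_I[OF int emission(1)[OF t] emission(1)[OF elim], of \<sigma>] \<sigma> False
          by force
      qed
    qed
  qed
qed

text \<open>
  From \<open>g(L x, L x) = g(L t, L t)\<close> one gets \<open>g(\<beta>' (s x) - \<beta>' (s t), N) = g(\<beta> x - \<beta> t, N)\<close> with
  \<open>N = L x + L t\<close>, which expresses the difference quotient of \<open>s\<close> through those of \<open>\<beta>\<close> and \<open>\<beta>'\<close>.
\<close>
lemma s_has_derivative:
  assumes t: "t \<in> I"
  shows "(s has_vector_derivative mink (L t) (U t) / mink (L t) (U' (s t))) (at t within I)"
proof -
  define m where "m = (\<lambda>x. if x = t then U t else (\<beta> x - \<beta> t) /\<^sub>R (x - t))"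
  define m' where "m' = (\<lambda>\<sigma>. if \<sigma> = s t then U' (s t)
    else (\<beta>' \<sigma> - \<beta>' (s t)) /\<^sub>R (\<sigma> - s t))"
  define N where "N = (\<lambda>x. L x + L t)"
  note st = emission(1)[OF t]
  have in_I: "\<forall>\<^sub>F x in at t within I. x \<in> I"
    by (auto simp: eventually_at_filter)
  have s_in: "\<forall>\<^sub>F x in at t within I. s x \<in> I'"
    using in_I by (rule eventually_mono) (rule emission(1))
  have m: "(m \<longlongrightarrow> U t) (at t within I)"
    unfolding m_def by (rule has_vector_derivative_slope[OF observer_has_four_velocity[OF obs t]])
  have m'_within: "(m' \<longlongrightarrow> m' (s t)) (at (s t) within I')"
    using has_vector_derivative_slope[OF observer_has_four_velocity[OF obs' st]]
    by (simp add: m'_def)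
  have "((\<lambda>x. m' (s x)) \<longlongrightarrow> m' (s t)) (at t within I)"
    by (rule continuous_within_tendsto_compose[OF _ s_in s_tendsto[OF t]])
      (use m'_within in \<open>simp add: continuous_within\<close>)
  then have m': "((\<lambda>x. m' (s x)) \<longlongrightarrow> U' (s t)) (at t within I)"
    by (simp add: m'_def)
  have \<beta>: "(\<beta> \<longlongrightarrow> \<beta> t) (at t within I)"
    using has_vector_derivative_continuous[OF observer_has_four_velocity[OF obs t]]
    by (simp add: continuous_within)
  have "((\<lambda>x. \<beta>' (s x)) \<longlongrightarrow> \<beta>' (s t)) (at t within I)"
    by (rule continuous_within_tendsto_compose[OF
          has_vector_derivative_continuous[OF observer_has_four_velocity[OF obs' st]]
          s_in s_tendsto[OF t]])
  then have N: "(N \<longlongrightarrow> L t + L t) (at t within I)"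
    unfolding N_def by (intro tendsto_intros \<beta>)
  have pos: "0 < mink (L t) (U' (s t))"
    by (rule mink_L_pos[OF t four_velocity_future(1)[OF obs' st]])
  have lim': "((\<lambda>x. mink (N x) (m' (s x))) \<longlongrightarrow> mink (L t + L t) (U' (s t))) (at t within I)"
    by (rule mink.tendsto[OF N m'])
  have "0 < mink (L t + L t) (U' (s t))"
    unfolding mink.add_left using add_pos_pos[OF pos pos] .
  \<comment> \<open>Near \<open>t\<close> the denominator \<open>mink (N x) (m' (s x))\<close> is
    positive, so division by it is legitimate.\<close>
  note ev = order_tendstoD(1)[OF lim' this]
  have "((\<lambda>x. mink (N x) (m x) / mink (N x) (m' (s x))) \<longlongrightarrow>
      mink (L t + L t) (U t) / mink (L t + L t) (U' (s t))) (at t within I)"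
    using \<open>0 < mink (L t + L t) (U' (s t))\<close>
    by (intro tendsto_divide mink.tendsto N m lim') simp
  moreover have "mink (L t + L t) (U t) / mink (L t + L t) (U' (s t)) =
      mink (L t) (U t) / mink (L t) (U' (s t))"
    unfolding mink.add_left mult_2[symmetric] by (rule mult_divide_mult_cancel_left) simp
  moreover have "\<forall>\<^sub>F x in at t within I.
      mink (N x) (m x) / mink (N x) (m' (s x)) = (s x - s t) /\<^sub>R (x - t)"
  proof -
    have "\<forall>\<^sub>F x in at t within I. x \<noteq> t" by (auto simp: eventually_at_filter)
    with ev in_I show ?thesis
    proof eventually_elim
      case (elim x)
      \<comment> \<open>This includes the case \<open>s x = s t\<close>, where both sides
        vanish.\<close>
      have \<Delta>': "\<beta>' (s x) - \<beta>' (s t) = (s x - s t) *\<^sub>R m' (s x)" by (simp add: m'_def)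
      have \<Delta>: "\<beta> x - \<beta> t = (x - t) *\<^sub>R m x" using elim by (simp add: m_def)
      have "mink (N x) (L x - L t) = mink (L x) (L x) - mink (L t) (L t)"
        unfolding N_def mink.add_left mink.diff_right[of _ "L x" "L t"]
        using mink_commute[of "L x" "L t"] by linarith
      then have "mink (N x) (L x - L t) = 0"
        using emission(5)[OF t] emission(5)[OF elim(2)] by simp
      moreover have "L x - L t = (\<beta>' (s x) - \<beta>' (s t)) - (\<beta> x - \<beta> t)" by simp
      ultimately have "mink (N x) ((s x - s t) *\<^sub>R m' (s x) - (x - t) *\<^sub>R m x) = 0"
        by (simp only: \<Delta> \<Delta>')
      then have "(s x - s t) * mink (N x) (m' (s x)) = (x - t) * mink (N x) (m x)"
        by (simp add: mink.diff_right mink.scaleR_right)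
      then show ?case using elim by (simp add: field_simps)
    qed
  qed
  ultimately show ?thesis
    by (auto simp: has_vector_derivative_iff_slope intro: Lim_transform_eventually)
qed

section \<open>The relative position and velocities\<close>

lemma S_obs_eq:
  assumes "t \<in> I"
  shows "S_obs I \<beta> I' \<beta>' t = L t + mink (L t) (U t) *\<^sub>R U t"
  by (simp add: S_obs_def Let_def emission(2)[OF assms])

lemma V_spec_eq:
  "V_spec I \<beta> I' \<beta>' t = (1 / (- mink (U' (s t)) (U t))) *\<^sub>R U' (s t) - U t"
  by (simp add: V_spec_def Let_def four_velocity_at_def emission_time_def)

text \<open>As \<open>L\<close> is null and \<open>g(U, U) = -1\<close>, the square of
  \<open>S = L + r U\<close> is \<open>2 r^2 - r^2\<close>; positivity of \<open>r\<close> fixes the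
  root.\<close>

lemma mnorm_S_obs:
  assumes "t \<in> I"
  shows "mnorm (S_obs I \<beta> I' \<beta>' t) = mink (L t) (U t)"
proof -
  have "mink (S_obs I \<beta> I' \<beta>' t) (S_obs I \<beta> I' \<beta>' t) = (mink (L t) (U t))\<^sup>2"
    unfolding S_obs_eq[OF assms] mink.add_left mink.add_right mink.scaleR_left mink.scaleR_right
      emission(5)[OF assms] four_velocity_future(3)[OF obs assms] mink_commute[of "U t" "L t"]
    by (simp add: power2_eq_square)
  then show ?thesis
    using mink_L_pos[OF assms four_velocity_future(1)[OF obs assms]] by (simp add: mnorm_def)
qed

lemma V_ast_eq:
  assumes t: "t \<in> I"
  shows "V_ast I \<beta> I' \<beta>' t = mink (L t) (U t) *\<^sub>R nabla_along I U t +
    (mink (L t) (U t) / mink (L t) (U' (s t))) *\<^sub>R (U' (s t) + mink (U' (s t)) (U t) *\<^sub>R U t)"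
proof -
  define r where "r = mink (L t) (U t)"
  define k where "k = mink (L t) (U t) / mink (L t) (U' (s t))"
  define a where "a = nabla_along I U t"
  \<comment> \<open>The derivative of \<open>mink (L x) (U x)\<close> at \<open>t\<close>. It enters
    only as a multiple of \<open>U t\<close>, so it cancels in the projection.\<close>
  define r' where "r' = mink (L t) a + mink (k *\<^sub>R U' (s t) - U t) (U t)"
  note U_der = observer_has_acceleration[OF obs t, folded a_def]
  \<comment> \<open>The chain rule needs the derivative of \<open>\<beta>'\<close> only within the
    image of \<open>s\<close>, a subset of \<open>I'\<close>.\<close>
  have "(\<beta>' has_vector_derivative U' (s t)) (at (s t) within s ` I)"
    using observer_has_four_velocity[OF obs' emission(1)[OF t]] emission(1)
    by (auto intro: has_vector_derivative_within_subset)
  then have "(\<beta>' \<circ> s has_vector_derivative k *\<^sub>R U' (s t)) (at t within I)"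
    using vector_diff_chain_within[OF s_has_derivative[OF t]] by (simp add: k_def)
  then have L_der: "(L has_vector_derivative k *\<^sub>R U' (s t) - U t) (at t within I)"
    using has_vector_derivative_diff observer_has_four_velocity[OF obs t] by (fastforce simp: o_def)
  have "((\<lambda>x. mink (L x) (U x)) has_vector_derivative r') (at t within I)"
    unfolding r'_def by (rule mink.has_vector_derivative[OF L_der U_der])
  from bounded_bilinear.has_vector_derivative[OF bounded_bilinear_scaleR this U_der]
  have "((\<lambda>x. L x + mink (L x) (U x) *\<^sub>R U x) has_vector_derivative
      (k *\<^sub>R U' (s t) - U t) + (r *\<^sub>R a + r' *\<^sub>R U t)) (at t within I)"
    unfolding r_def by (rule has_vector_derivative_add[OF L_der])
  then have "(S_obs I \<beta> I' \<beta>' has_vector_derivative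
      (k *\<^sub>R U' (s t) - U t) + (r *\<^sub>R a + r' *\<^sub>R U t)) (at t within I)"
    by (rule has_vector_derivative_transform[OF t, rotated]) (simp add: S_obs_eq)
  then have W: "nabla_along I (S_obs I \<beta> I' \<beta>') t =
      (k *\<^sub>R U' (s t) - U t) + (r *\<^sub>R a + r' *\<^sub>R U t)"
    unfolding nabla_along_def by (rule observer_vector_derivative[OF obs t])
  have aU: "mink a (U t) = 0"
    unfolding a_def by (rule acceleration_orthogonal[OF obs t])
  have "mink (nabla_along I (S_obs I \<beta> I' \<beta>') t) (U t) = k * mink (U' (s t)) (U t) + 1 - r'"
    unfolding W mink.add_left mink.diff_left mink.scaleR_left aU
      four_velocity_future(3)[OF obs t] by simp
  then have "V_ast I \<beta> I' \<beta>' t = (k *\<^sub>R U' (s t) - U t) + (r *\<^sub>R a + r' *\<^sub>R U t) +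
      (k * mink (U' (s t)) (U t) + 1 - r') *\<^sub>R U t"
    by (simp add: V_ast_def Let_def W)
  also have "\<dots> = r *\<^sub>R a + k *\<^sub>R (U' (s t) + mink (U' (s t)) (U t) *\<^sub>R U t)"
    by (simp add: algebra_simps)
  finally show ?thesis by (simp add: r_def k_def a_def)
qed

lemma V_ast_decomposition:
  assumes t: "t \<in> I"
  shows "V_ast I \<beta> I' \<beta>' t =
      mnorm (S_obs I \<beta> I' \<beta>' t) *\<^sub>R nabla_along I U t +
      (1 / (1 + mink (V_spec I \<beta> I' \<beta>' t)
                     ((1 / mnorm (S_obs I \<beta> I' \<beta>' t)) *\<^sub>R S_obs I \<beta> I' \<beta>' t)))
        *\<^sub>R V_spec I \<beta> I' \<beta>' t"
proof -
  define r where "r = mink (L t) (U t)"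
  define c where "c = mink (L t) (U' (s t))"
  \<comment> \<open>The Lorentz factor of \<open>\<beta>'\<close> at emission relative to
    \<open>\<beta>\<close> at reception.\<close>
  define \<gamma> where "\<gamma> = - mink (U' (s t)) (U t)"
  note st = emission(1)[OF t]
  have "0 < r" "0 < c"
    unfolding r_def c_def
    by (auto intro!: mink_L_pos[OF t] four_velocity_future obs obs' t st)
  have "0 < \<gamma>"
    unfolding \<gamma>_def
    using mink_neg[of "U' (s t)" "U t"] four_velocity_future[OF obs t] four_velocity_future[OF obs' st]
    by simp
  have V: "V_spec I \<beta> I' \<beta>' t = (1 / \<gamma>) *\<^sub>R U' (s t) - U t"
    by (simp add: V_spec_eq \<gamma>_def)
  have S: "S_obs I \<beta> I' \<beta>' t = L t + r *\<^sub>R U t"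
    by (simp only: S_obs_eq[OF t] r_def)
  have UL: "mink (U t) (L t) = r" "mink (U' (s t)) (L t) = c"
    by (simp_all only: r_def c_def mink_commute)
  have "mink (V_spec I \<beta> I' \<beta>' t) (S_obs I \<beta> I' \<beta>' t) =
      (1 / \<gamma>) * (c + r * mink (U' (s t)) (U t)) - (r + r * mink (U t) (U t))"
    unfolding V S mink.diff_left mink.scaleR_left mink.add_right mink.scaleR_right UL
    by (simp add: algebra_simps add_divide_distrib)
  also have "\<dots> = c / \<gamma> - r"
    using \<open>0 < \<gamma>\<close> four_velocity_future(3)[OF obs t] by (simp add: \<gamma>_def field_simps)
  finally have "1 + mink (V_spec I \<beta> I' \<beta>' t) ((1 / r) *\<^sub>R S_obs I \<beta> I' \<beta>' t) = c / (\<gamma> * r)"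
    using \<open>0 < r\<close> by (simp add: mink.scaleR_right field_simps)
  \<comment> \<open>Here \<open>r / c\<close> is the derivative of \<open>s\<close> at
    \<open>t\<close>, the factor in \<open>V_ast_eq\<close>; the remaining \<open>\<gamma>\<close>
    comes from \<open>U' - \<gamma> U = \<gamma> V_spec\<close>.\<close>
  then have coeff: "1 / (1 + mink (V_spec I \<beta> I' \<beta>' t) ((1 / r) *\<^sub>R S_obs I \<beta> I' \<beta>' t)) =
      (r / c) * \<gamma>"
    by simp
  have "U' (s t) + mink (U' (s t)) (U t) *\<^sub>R U t = \<gamma> *\<^sub>R V_spec I \<beta> I' \<beta>' t"
    unfolding V using \<open>0 < \<gamma>\<close> by (simp add: scaleR_diff_right) (simp add: \<gamma>_def)
  then have "V_ast I \<beta> I' \<beta>' t = r *\<^sub>R nabla_along I U t + ((r / c) * \<gamma>) *\<^sub>R V_spec I \<beta> I' \<beta>' t"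
    unfolding V_ast_eq[OF t] r_def[symmetric] c_def[symmetric] by simp
  then show ?thesis
    unfolding mnorm_S_obs[OF t] r_def[symmetric] coeff .
qed

end

theorem corollary5p2:
  fixes I I' :: "real set" and \<beta> \<beta>' :: "real \<Rightarrow> minkowski"
  assumes "observer I \<beta>"
    and "observer I' \<beta>'"
    and "\<forall>p \<in> \<beta> ` I. \<exists>!q. q \<in> \<beta>' ` I' \<inter> past_lightcone p"
  shows "\<forall>t\<in>I.
    V_ast I \<beta> I' \<beta>' t =
      mnorm (S_obs I \<beta> I' \<beta>' t) *\<^sub>R nabla_along I (four_velocity I \<beta>) t +
      (1 / (1 + mink (V_spec I \<beta> I' \<beta>' t)
                     ((1 / mnorm (S_obs I \<beta> I' \<beta>' t)) *\<^sub>R S_obs I \<beta> I' \<beta>' t)))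
        *\<^sub>R V_spec I \<beta> I' \<beta>' t"
proof -
  interpret light_observation I I' \<beta> \<beta>'
    using assms by unfold_locales
  show ?thesis using V_ast_decomposition by blast
qed

end
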